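(* Every initial segment complex is a shifted complex. Moreover, there are shifted complexes that are not initial segment complexes.
   Context: $[n]=\{1,\dots,n\}$ and $2^{[n]}$ is the set of all subsets of $[n]$. An order is a reflexive, complete and transitive binary relation. A qualitative probability order on $[n]$ is an order $\preceq$ on $2^{[n]}$ such that (1) $\emptyset\preceq A$ for every nonempty $A\subseteq[n]$, and (2) for all $A,B,C\subseteq[n]$ with $(A\cup B)\cap C=\emptyset$: $A\preceq B\iff A\cup C\preceq B\cup C$. $X\prec Y$ means $X\preceq Y$ but not $Y\preceq X$. The initial segment determined by $T\subseteq[n]$ is $\Delta(\preceq,T)=\{X\subseteq[n]\mid X\prec T\}$; it is a simplicial complex (a family of subsets of $[n]$, called faces, closed under taking subsets). A simplicial complex $\Delta\subseteq 2^{[n]}$ is an initial segment complex if $\Delta=\Delta(\preceq,T)$ for some qualitative probability order $\preceq$ on $[n]$ and some $T\subseteq[n]$. A simplicial complex $\Delta\subseteq2^{[n]}$ is shifted if there is an order $\trianglelefteq$ on $[n]$ such that for every face $F\in\Delta$, every $x\in F$ and every $y\in[n]$ with $y\trianglelefteq x$, the set $(F\setminus\{x\})\cup\{y\}$ is also a face. *)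

theory Defs
  imports Main
begin

(* Orders are total preorders, not necessarily antisymmetric.  A relation on A is encoded as a
   binary predicate of which only the restriction to A matters; totalp_on speaks about distinct
   elements only, so completeness is the conjunction of reflp_on and totalp_on. *)
definition order_rel_on :: "'a set \<Rightarrow> ('a \<Rightarrow> 'a \<Rightarrow> bool) \<Rightarrow> bool" where
  "order_rel_on A R \<longleftrightarrow> reflp_on A R \<and> totalp_on A R \<and> transp_on A R"

definition strict_part :: "('a \<Rightarrow> 'a \<Rightarrow> bool) \<Rightarrow> 'a \<Rightarrow> 'a \<Rightarrow> bool" where
  "strict_part R x y \<longleftrightarrow> R x y \<and> \<not> R y x"

definition qualitative_probability_order :: "nat \<Rightarrow> (nat set \<Rightarrow> nat set \<Rightarrow> bool) \<Rightarrow> bool" where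
  "qualitative_probability_order n R \<longleftrightarrow>
     order_rel_on (Pow {1..n}) R \<and>
     (\<forall>A \<subseteq> {1..n}. A \<noteq> {} \<longrightarrow> R {} A) \<and>
     (\<forall>A \<subseteq> {1..n}. \<forall>B \<subseteq> {1..n}. \<forall>C \<subseteq> {1..n}. (A \<union> B) \<inter> C = {} \<longrightarrow>
        (R A B \<longleftrightarrow> R (A \<union> C) (B \<union> C)))"

definition initial_segment :: "nat \<Rightarrow> (nat set \<Rightarrow> nat set \<Rightarrow> bool) \<Rightarrow> nat set \<Rightarrow> nat set set" where
  "initial_segment n R T = {X. X \<subseteq> {1..n} \<and> strict_part R X T}"

(* The empty family is admitted; it is the initial segment determined by T = {}. *)
definition simplicial_complex :: "nat \<Rightarrow> nat set set \<Rightarrow> bool" where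
  "simplicial_complex n \<Delta> \<longleftrightarrow> \<Delta> \<subseteq> Pow {1..n} \<and> (\<forall>F\<in>\<Delta>. \<forall>G \<subseteq> F. G \<in> \<Delta>)"

definition initial_segment_complex :: "nat \<Rightarrow> nat set set \<Rightarrow> bool" where
  "initial_segment_complex n \<Delta> \<longleftrightarrow>
     simplicial_complex n \<Delta> \<and>
     (\<exists>R T. qualitative_probability_order n R \<and> T \<subseteq> {1..n} \<and> \<Delta> = initial_segment n R T)"

definition shifted_complex :: "nat \<Rightarrow> nat set set \<Rightarrow> bool" where
  "shifted_complex n \<Delta> \<longleftrightarrow>
     simplicial_complex n \<Delta> \<and>
     (\<exists>S :: nat \<Rightarrow> nat \<Rightarrow> bool. order_rel_on {1..n} S \<and>
        (\<forall>F\<in>\<Delta>. \<forall>x\<in>F. \<forall>y\<in>{1..n}. S y x \<longrightarrow> (F - {x}) \<union> {y} \<in> \<Delta>))"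

(* Hence the first conjunct in initial_segment_complex is no restriction. *)
lemma simplicial_complex_initial_segment:
  assumes R: "qualitative_probability_order n R" and T: "T \<subseteq> {1..n}"
  shows "simplicial_complex n (initial_segment n R T)"
  unfolding simplicial_complex_def
proof (intro conjI ballI allI impI)
  show "initial_segment n R T \<subseteq> Pow {1..n}"
    by (auto simp: initial_segment_def)
next
  fix F G assume F: "F \<in> initial_segment n R T" and "G \<subseteq> F"
  then have sub: "F \<subseteq> {1..n}" "G \<subseteq> {1..n}" "F - G \<subseteq> {1..n}" and FT: "R F T" "\<not> R T F"
    by (auto simp: initial_segment_def strict_part_def)
  have GF: "R G F"
  proof (cases "F - G = {}")
    case True
    with \<open>G \<subseteq> F\<close> have "G = F" by blast
    then show ?thesis
      using R sub by (auto simp: qualitative_probability_order_def order_rel_on_def reflp_on_def)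
  next
    case False
    then have "R {} (F - G)"
      using R sub unfolding qualitative_probability_order_def by blast
    moreover have "({} \<union> (F - G)) \<inter> G = {}" by blast
    ultimately have "R ({} \<union> G) ((F - G) \<union> G)"
      using R sub unfolding qualitative_probability_order_def by blast
    moreover have "(F - G) \<union> G = F" using \<open>G \<subseteq> F\<close> by blast
    ultimately show ?thesis by simp
  qed
  have tr: "transp_on (Pow {1..n}) R"
    using R by (simp add: qualitative_probability_order_def order_rel_on_def)
  have "R G T" using transp_onD[OF tr _ _ _ GF FT(1)] sub T by blast
  moreover have "\<not> R T G" using transp_onD[OF tr _ _ _ _ GF] sub T FT(2) by blast
  ultimately show "G \<in> initial_segment n R T"
    using sub by (simp add: initial_segment_def strict_part_def)
qed

end

(* If R is a qualitative probability order and {y} is below {x}, then exchanging x for y in a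
   face of an initial segment moves the face down in R; so comparing singletons by R makes the
   complex shifted.

   Conversely, if F is in an initial segment and G is not, then F lies strictly below G, also
   after removing common elements.  So an initial segment cannot contain U \<union> C and V \<union> D but
   neither V \<union> C nor U \<union> D when C and D are disjoint from U and V: the first pair would put U
   strictly below V, the second V strictly below U.  In the family of subsets of {1..6} that
   have at most two elements, or avoid 6 and do not contain {3, 4, 5}, this happens for U = {3},
   V = {1, 2}, C = {6}, D = {4, 5}, but the family is shifted for the preorder with levels
   {1, 2}, {3, 4, 5}, {6}, i.e. by the value of x div 3. *)

theory Submission
  imports Defs
begin

lemma qualitative_probability_order_trans:
  assumes "qualitative_probability_order n R" "R A B" "R B C"
    and "A \<subseteq> {1..n}" "B \<subseteq> {1..n}" "C \<subseteq> {1..n}"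
  shows "R A C"
proof -
  have "transp_on (Pow {1..n}) R"
    using assms(1) unfolding qualitative_probability_order_def order_rel_on_def by (elim conjE)
  then show ?thesis by (rule transp_onD[of _ _ A B C]) (use assms in simp_all)
qed

lemma qualitative_probability_order_total:
  assumes "qualitative_probability_order n R" "A \<subseteq> {1..n}" "B \<subseteq> {1..n}"
  shows "R A B \<or> R B A"
proof -
  have "totalp_on (Pow {1..n}) R"
    using assms(1) unfolding qualitative_probability_order_def order_rel_on_def by (elim conjE)
  moreover have "reflp_on (Pow {1..n}) R"
    using assms(1) unfolding qualitative_probability_order_def order_rel_on_def by (elim conjE)
  ultimately show ?thesis
    using totalp_onD[of "Pow {1..n}" R A B] reflp_onD[of "Pow {1..n}" R A] assms(2,3)
    by (cases "A = B") auto
qed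

lemma qualitative_probability_order_union_iff:
  assumes "qualitative_probability_order n R" "A \<subseteq> {1..n}" "B \<subseteq> {1..n}" "C \<subseteq> {1..n}"
    and "(A \<union> B) \<inter> C = {}"
  shows "R (A \<union> C) (B \<union> C) \<longleftrightarrow> R A B"
proof -
  have "\<forall>A \<subseteq> {1..n}. \<forall>B \<subseteq> {1..n}. \<forall>C \<subseteq> {1..n}. (A \<union> B) \<inter> C = {} \<longrightarrow>
      (R A B \<longleftrightarrow> R (A \<union> C) (B \<union> C))"
    using assms(1) unfolding qualitative_probability_order_def by (elim conjE)
  from this[rule_format, OF assms(2-5)] show ?thesis by (rule sym)
qed

text \<open>Strictness passes from \<open>F\<close> to \<open>G\<close> by transitivity: if
  \<open>T\<close> were below \<open>G\<close>, it would be below \<open>F\<close>. Both halves of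
  the theorem use this closure under \<open>R\<close>.\<close>

lemma initial_segment_downward:
  assumes "qualitative_probability_order n R" "T \<subseteq> {1..n}"
    and "F \<in> initial_segment n R T" "G \<subseteq> {1..n}" "R G F"
  shows "G \<in> initial_segment n R T"
  using assms qualitative_probability_order_trans[of n R G F T]
    qualitative_probability_order_trans[of n R T G F]
  by (auto simp: initial_segment_def strict_part_def)

lemma shifted_complex_if_initial_segment_complex:
  assumes "initial_segment_complex n \<Delta>"
  shows "shifted_complex n \<Delta>"
proof -
  obtain R T where R: "qualitative_probability_order n R" and T: "T \<subseteq> {1..n}"
    and \<Delta>: "\<Delta> = initial_segment n R T" and sc: "simplicial_complex n \<Delta>"
    using assms unfolding initial_segment_complex_def by blast
  let ?S = "\<lambda>y x. R {y} {x}"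
  have "order_rel_on {1..n} ?S"
    unfolding order_rel_on_def
  proof (intro conjI)
    show "reflp_on {1..n} ?S"
    proof (rule reflp_onI)
      fix x assume "x \<in> {1..n}"
      then show "R {x} {x}"
        using qualitative_probability_order_total[OF R, of "{x}" "{x}"] by simp
    qed
    show "totalp_on {1..n} ?S"
      by (rule totalp_onI, rule qualitative_probability_order_total[OF R]) auto
    show "transp_on {1..n} ?S"
      by (rule transp_onI, rule qualitative_probability_order_trans[OF R]) auto
  qed
  moreover have "(F - {x}) \<union> {y} \<in> \<Delta>"
    if F: "F \<in> \<Delta>" and x: "x \<in> F" and y: "y \<in> {1..n}" and le: "R {y} {x}" for F x y
  proof (cases "y \<in> F - {x}")
    \<comment> \<open>Here \<open>{y}\<close> meets \<open>F - {x}\<close>, so additivity cannot be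
      applied; but the exchange merely deletes \<open>x\<close>, and closure under subsets
      suffices.\<close>
    case True
    then have "(F - {x}) \<union> {y} \<subseteq> F" by blast
    then show ?thesis using sc F unfolding simplicial_complex_def by blast
  next
    case False
    have sub: "F \<subseteq> {1..n}" using F sc unfolding simplicial_complex_def by blast
    have "R ({y} \<union> (F - {x})) ({x} \<union> (F - {x}))"
      by (subst qualitative_probability_order_union_iff[OF R]) (use False x y sub le in auto)
    moreover have "{x} \<union> (F - {x}) = F" using x by blast
    ultimately have "R ((F - {x}) \<union> {y}) F" by (simp add: Un_commute)
    moreover have "(F - {x}) \<union> {y} \<subseteq> {1..n}" using sub y by blast
    ultimately show ?thesis
      using initial_segment_downward[OF R T] F by (simp add: \<Delta>)
  qed
  ultimately show ?thesis
    using sc unfolding shifted_complex_def by (auto intro!: exI[of _ ?S])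
qed

text \<open>By additivity, \<open>R V U\<close> would survive adding the common part
  \<open>C\<close>, and downward closure would then force \<open>V \<union> C\<close> into the
  segment.\<close>

lemma initial_segment_exchange:
  assumes R: "qualitative_probability_order n R" and T: "T \<subseteq> {1..n}"
    and sub: "U \<subseteq> {1..n}" "V \<subseteq> {1..n}" "C \<subseteq> {1..n}" and disj: "(U \<union> V) \<inter> C = {}"
    and mem: "U \<union> C \<in> initial_segment n R T" "V \<union> C \<notin> initial_segment n R T"
  shows "\<not> R V U"
proof
  assume "R V U"
  moreover have "(V \<union> U) \<inter> C = {}" using disj by blast
  ultimately have "R (V \<union> C) (U \<union> C)"
    using qualitative_probability_order_union_iff[OF R] sub by simp
  moreover have "V \<union> C \<subseteq> {1..n}" using sub by simp
  ultimately show False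
    using initial_segment_downward[OF R T mem(1)] mem(2) by simp
qed

text \<open>The exchange lemma through \<open>C\<close>, and through \<open>D\<close> with
  \<open>U\<close> and \<open>V\<close> swapped, makes \<open>U\<close> and \<open>V\<close>
  incomparable, against completeness of \<open>R\<close>.\<close>

lemma not_initial_segment_complex_if_exchange:
  assumes "U \<subseteq> {1..n}" "V \<subseteq> {1..n}" "C \<subseteq> {1..n}" "D \<subseteq> {1..n}"
    and "(U \<union> V) \<inter> C = {}" "(U \<union> V) \<inter> D = {}"
    and "U \<union> C \<in> \<Delta>" "V \<union> C \<notin> \<Delta>" "V \<union> D \<in> \<Delta>" "U \<union> D \<notin> \<Delta>"
  shows "\<not> initial_segment_complex n \<Delta>"
proof
  assume "initial_segment_complex n \<Delta>"
  then obtain R T where R: "qualitative_probability_order n R" and T: "T \<subseteq> {1..n}"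
    and \<Delta>: "\<Delta> = initial_segment n R T"
    unfolding initial_segment_complex_def by blast
  have "\<not> R V U"
    using initial_segment_exchange[OF R T, of U V C] assms by (simp add: \<Delta>)
  moreover have "\<not> R U V"
    using initial_segment_exchange[OF R T, of V U D] assms by (simp add: \<Delta> Un_commute)
  ultimately show False
    using qualitative_probability_order_total[OF R] assms(1,2) by blast
qed

text \<open>Only an inequality, since \<open>y\<close> may already lie in \<open>F - {x}\<close>;
  the size then drops by one.\<close>

lemma card_exchange_le:
  assumes "finite F" "x \<in> F"
  shows "card (insert y (F - {x})) \<le> card F"
  using assms card_insert_le_m1[of "card F" "F - {x}" y] by (simp add: card_gt_0_iff) blast

text \<open>Not containing \<open>{3, 4, 5}\<close> is phrased by cardinality, so that closure under
  subsets and under exchanges both become counting arguments.\<close>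

definition shifted_example :: "nat set set" where
  "shifted_example =
     {X. X \<subseteq> {1..6} \<and> (card X \<le> 2 \<or> 6 \<notin> X \<and> card (X \<inter> {3, 4, 5}) \<le> 2)}"

lemma shifted_complex_shifted_example: "shifted_complex 6 shifted_example"
proof -
  have fin: "finite F" if "F \<in> shifted_example" for F
    using that unfolding shifted_example_def by (blast intro: finite_subset)
  have "G \<in> shifted_example" if F: "F \<in> shifted_example" and G: "G \<subseteq> F" for F G
  proof -
    have "card G \<le> card F" "card (G \<inter> {3, 4, 5}) \<le> card (F \<inter> {3, 4, 5})"
      using G fin[OF F] by (auto intro!: card_mono)
    moreover have "G \<subseteq> {1..6}" "6 \<in> G \<Longrightarrow> 6 \<in> F"
      using F G unfolding shifted_example_def by blast+
    ultimately show ?thesis using F unfolding shifted_example_def by simp linarith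
  qed
  moreover have "shifted_example \<subseteq> Pow {1..6}"
    unfolding shifted_example_def by blast
  ultimately have "simplicial_complex 6 shifted_example"
    unfolding simplicial_complex_def by blast
  moreover have "order_rel_on {1..6} (\<lambda>y x. y div 3 \<le> x div (3::nat))"
    unfolding order_rel_on_def by (auto intro!: reflp_onI totalp_onI transp_onI)
  moreover have "insert y (F - {x}) \<in> shifted_example"
    if F: "F \<in> shifted_example" and x: "x \<in> F" and y: "y \<in> {1..6}" and le: "y div 3 \<le> x div 3"
    for F x y
  proof -
    let ?G = "insert y (F - {x})"
    have sub: "F \<subseteq> {1..6}" using F unfolding shifted_example_def by blast
    then have G: "?G \<subseteq> {1..6}" using y by blast
    consider "card F \<le> 2" | "6 \<notin> F" "card (F \<inter> {3, 4, 5}) \<le> 2"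
      using F unfolding shifted_example_def by blast
    then show ?thesis
    proof cases
      case 1
      then show ?thesis
        using G card_exchange_le[OF fin[OF F] x, of y] unfolding shifted_example_def by simp
    next
      case 2
      have "x \<noteq> 6" "x \<in> {1..6}" using 2(1) x sub by blast+
      then have x5: "x \<le> 5" by simp
      \<comment> \<open>The level of \<open>x\<close> is at most 1, whereas 6 has level 2.\<close>
      then have "y \<noteq> 6" using le by auto
      have "card (?G \<inter> {3, 4, 5}) \<le> card (F \<inter> {3, 4, 5})"
      proof (cases "y \<in> {3, 4, 5}")
        case True
        \<comment> \<open>A new element of level 1 can only replace one of level at least 1, hence
          one of \<open>{3, 4, 5}\<close> as \<open>x \<le> 5\<close>.\<close>
        then have "3 \<le> x" using le by auto
        then have "x \<in> {3, 4, 5}" using x5 by auto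
        then have "?G \<inter> {3, 4, 5} = insert y ((F \<inter> {3, 4, 5}) - {x})"
          using True by blast
        then show ?thesis
          using card_exchange_le[of "F \<inter> {3, 4, 5}" x y] x \<open>x \<in> {3, 4, 5}\<close> by simp
      next
        case False
        \<comment> \<open>The trace on \<open>{3, 4, 5}\<close> gains nothing from
          \<open>y\<close>.\<close>
        then show ?thesis by (intro card_mono) auto
      qed
      then show ?thesis
        using 2 \<open>y \<noteq> 6\<close> G unfolding shifted_example_def by simp
    qed
  qed
  ultimately show ?thesis
    unfolding shifted_complex_def
    by (intro conjI exI[of _ "\<lambda>y x. y div 3 \<le> x div (3::nat)"] ballI impI) simp_all
qed

lemma not_initial_segment_complex_shifted_example:
  "\<not> initial_segment_complex 6 shifted_example"
  \<comment> \<open>The faces are \<open>{3, 6}\<close> and \<open>{1, 2, 4, 5}\<close>; the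
    non-faces are \<open>{1, 2, 6}\<close>, with three elements including 6, and
    \<open>{3, 4, 5}\<close>.\<close>
  by (rule not_initial_segment_complex_if_exchange
      [where U = "{3}" and V = "{1, 2}" and C = "{6}" and D = "{4, 5}"])
    (auto simp: shifted_example_def)

theorem corollary1:
  "(\<forall>n \<Delta>. initial_segment_complex n \<Delta> \<longrightarrow> shifted_complex n \<Delta>) \<and>
   (\<exists>n\<ge>1. \<exists>\<Delta>. shifted_complex n \<Delta> \<and> \<not> initial_segment_complex n \<Delta>)"
proof (intro conjI allI impI)
  fix n \<Delta>
  assume "initial_segment_complex n \<Delta>"
  then show "shifted_complex n \<Delta>" by (rule shifted_complex_if_initial_segment_complex)
next
  have "(1::nat) \<le> 6" by simp
  then show "\<exists>n\<ge>1. \<exists>\<Delta>. shifted_complex n \<Delta> \<and> \<not> initial_segment_complex n \<Delta>"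
    using shifted_complex_shifted_example not_initial_segment_complex_shifted_example by blast
qed

end
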